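(* Let $\mathcal M_X=(\mathcal S,\Theta,\vec\pi)$ be a finite statistical model, $t\in\mathbb N$ with $t\ge1$, $H_0\subseteq\Theta$, $h_1\in\Theta\setminus H_0$. Suppose $\Lambda$ is a uniformly least favorable distribution for the composite vs. simple test $H_0$ vs. $h_1$ under $\mathcal M_X$. Then $\mathrm{Ext}(\Lambda,h_1,t)$ is a uniformly least favorable distribution for $\mathrm{Ext}(H_0,h_1,t)$ vs. $\vec h_1=(h_1,\ldots,h_1)\in\Theta^t$ in $(\mathcal M_X)^t$.
   Context: A statistical model $(\mathcal S,\Theta,\vec\pi)$ consists of a sample space $\mathcal S$, a parameter space $\Theta$ and probability distributions $\pi_\theta$ on $\mathcal S$ for $\theta\in\Theta$; it is finite if $\mathcal S$ and $\Theta$ are finite. The model $(\mathcal M_X)^t$ has sample space $\mathcal S^t$, parameter space $\Theta^t$, and $\pi_{(\theta_1,\dots,\theta_t)}(x_1,\dots,x_t)=\prod_{j=1}^t\pi_{\theta_j}(x_j)$. $\mathrm{Ext}(H_0,h_1,t)=(H_0\cup\{h_1\})^t\setminus\{\vec h_1\}$. $\mathrm{Ext}(\Lambda,h_1,t)$ is the distribution on $\Theta^t$ generated as follows: choose $j\in\{1,\dots,t\}$ uniformly at random, set all components except the $j$-th equal to $h_1$, and draw the $j$-th component from $\Lambda$; i.e. the vector with $j$-th component $\theta\in H_0$ and all other components $h_1$ has probability $\frac1t\Lambda(\theta)$. For a model, a set $H_0$ of parameters and a parameter $h_1\notin H_0$: a (randomized) test is a function $f$ from the sample space to $[0,1]$;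 $\mathrm{Size}(f,h_0)=E_{P\sim\pi_{h_0}}f(P)$, $\mathrm{Size}(f)=\sup_{h_0\in H_0}\mathrm{Size}(f,h_0)$, $\mathrm{Power}(f,h_1)=E_{P\sim\pi_{h_1}}f(P)$. A level-$\alpha$ most powerful test for $H_0$ vs. $h_1$ is a test of size $\alpha$ whose power at $h_1$ is maximal among all tests of size at most $\alpha$. For a probability distribution $\Lambda$ over $H_0$ with support $\mathrm{Spt}(\Lambda)$, let $\mathrm{Ratio}_{\Lambda,h_1}(P)=\dfrac{\pi_{h_1}(P)}{\sum_{h_0\in H_0}\Lambda(h_0)\pi_{h_0}(P)}$; all likelihood ratios involved are assumed to be well-defined positive real numbers at every sample. For $0<\alpha<1$ the likelihood ratio test $\mathrm{LR}_{\alpha,\Lambda,h_1}(P)$ equals $1$ if $\mathrm{Ratio}_{\Lambda,h_1}(P)>k_\alpha$, $0$ if $\mathrm{Ratio}_{\Lambda,h_1}(P)<k_\alpha$, and $\gamma_\alpha$ if equality holds, where $k_\alpha\ge0$ and $\gamma_\alpha\in[0,1]$ are chosen so that $\sum_{h_0\in H_0}\Lambda(h_0)\,\mathrm{Size}(\mathrm{LR}_{\alpha,\Lambda,h_1},h_0)=\alpha$. $\Lambda$ is a (level-$\alpha$) least favorable distribution for $H_0$ vs. $h_1$ if $\mathrm{LR}_{\alpha,\Lambda,h_1}$ is a level-$\alpha$ most powerful test for $H_0$ vs. $h_1$; by a known result this is equivalent to: (i) $\mathrm{Size}(\mathrm{LR}_{\alpha,\Lambda,h_1},h_0^* )=\alpha$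 for all $h_0^*\in\mathrm{Spt}(\Lambda)$ and (ii) $\mathrm{Size}(\mathrm{LR}_{\alpha,\Lambda,h_1},h_0)\le\alpha$ for all $h_0\in H_0$. $\Lambda$ is uniformly least favorable if this holds for all $0<\alpha<1$. *)

theory Defs
  imports "HOL-Probability.Probability"
begin

record ('s, 'p) stat_model =
  samples :: "'s set"
  params :: "'p set"
  dist :: "'p \<Rightarrow> 's pmf"

definition stat_model :: "('s, 'p) stat_model \<Rightarrow> bool" where
  "stat_model M \<longleftrightarrow> (\<forall>\<theta>\<in>params M. set_pmf (dist M \<theta>) \<subseteq> samples M)"

definition finite_stat_model :: "('s, 'p) stat_model \<Rightarrow> bool" where
  "finite_stat_model M \<longleftrightarrow> stat_model M \<and> finite (samples M) \<and> finite (params M)"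

text \<open>
  Vectors of length \<open>t\<close> are extensional functions on \<open>{1..t}\<close>; the default value
  \<open>undefined\<close> of \<open>Pi_pmf\<close> makes the product distribution live on \<open>{1..t} \<rightarrow>\<^sub>E samples M\<close>.
\<close>

definition model_power :: "('s, 'p) stat_model \<Rightarrow> nat \<Rightarrow> (nat \<Rightarrow> 's, nat \<Rightarrow> 'p) stat_model" where
  "model_power M t =
     \<lparr> samples = {1..t} \<rightarrow>\<^sub>E samples M,
       params = {1..t} \<rightarrow>\<^sub>E params M,
       dist = (\<lambda>\<theta>. Pi_pmf {1..t} undefined (\<lambda>j. dist M (\<theta> j))) \<rparr>"

definition const_vec :: "'p \<Rightarrow> nat \<Rightarrow> nat \<Rightarrow> 'p" where
  "const_vec h t = (\<lambda>j\<in>{1..t}. h)"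

definition Ext_set :: "'p set \<Rightarrow> 'p \<Rightarrow> nat \<Rightarrow> (nat \<Rightarrow> 'p) set" where
  "Ext_set H0 h1 t = ({1..t} \<rightarrow>\<^sub>E (H0 \<union> {h1})) - {const_vec h1 t}"

definition Ext_pmf :: "'p pmf \<Rightarrow> 'p \<Rightarrow> nat \<Rightarrow> (nat \<Rightarrow> 'p) pmf" where
  "Ext_pmf \<Lambda> h1 t =
     bind_pmf (pmf_of_set {1..t}) (\<lambda>j. map_pmf (\<lambda>\<theta>. (const_vec h1 t)(j := \<theta>)) \<Lambda>)"

definition is_test :: "('s, 'p) stat_model \<Rightarrow> ('s \<Rightarrow> real) \<Rightarrow> bool" where
  "is_test M f \<longleftrightarrow> f \<in> samples M \<rightarrow> {0..1}"

definition size_at :: "('s, 'p) stat_model \<Rightarrow> ('s \<Rightarrow> real) \<Rightarrow> 'p \<Rightarrow> real" where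
  "size_at M f h0 = measure_pmf.expectation (dist M h0) f"

definition test_size :: "('s, 'p) stat_model \<Rightarrow> 'p set \<Rightarrow> ('s \<Rightarrow> real) \<Rightarrow> real" where
  "test_size M H0 f = (SUP h0\<in>H0. size_at M f h0)"

definition test_power :: "('s, 'p) stat_model \<Rightarrow> ('s \<Rightarrow> real) \<Rightarrow> 'p \<Rightarrow> real" where
  "test_power M f h1 = measure_pmf.expectation (dist M h1) f"

definition most_powerful ::
  "('s, 'p) stat_model \<Rightarrow> 'p set \<Rightarrow> 'p \<Rightarrow> real \<Rightarrow> ('s \<Rightarrow> real) \<Rightarrow> bool" where
  "most_powerful M H0 h1 \<alpha> f \<longleftrightarrow>
     is_test M f \<and> test_size M H0 f = \<alpha> \<and>
     (\<forall>g. is_test M g \<and> test_size M H0 g \<le> \<alpha> \<longrightarrow> test_power M g h1 \<le> test_power M f h1)"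

definition mixture :: "('s, 'p) stat_model \<Rightarrow> 'p set \<Rightarrow> 'p pmf \<Rightarrow> 's \<Rightarrow> real" where
  "mixture M H0 \<Lambda> x = (\<Sum>h0\<in>H0. pmf \<Lambda> h0 * pmf (dist M h0) x)"

definition LRatio :: "('s, 'p) stat_model \<Rightarrow> 'p set \<Rightarrow> 'p \<Rightarrow> 'p pmf \<Rightarrow> 's \<Rightarrow> real" where
  "LRatio M H0 h1 \<Lambda> x = pmf (dist M h1) x / mixture M H0 \<Lambda> x"

text \<open>The ratio is a well-defined positive real at every sample.\<close>

definition ratio_positive :: "('s, 'p) stat_model \<Rightarrow> 'p set \<Rightarrow> 'p \<Rightarrow> 'p pmf \<Rightarrow> bool" where
  "ratio_positive M H0 h1 \<Lambda> \<longleftrightarrow>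
     (\<forall>x\<in>samples M. pmf (dist M h1) x > 0 \<and> mixture M H0 \<Lambda> x > 0)"

definition threshold_test ::
  "('s, 'p) stat_model \<Rightarrow> 'p set \<Rightarrow> 'p \<Rightarrow> 'p pmf \<Rightarrow> real \<Rightarrow> real \<Rightarrow> 's \<Rightarrow> real" where
  "threshold_test M H0 h1 \<Lambda> k \<gamma> x =
     (if LRatio M H0 h1 \<Lambda> x > k then 1 else if LRatio M H0 h1 \<Lambda> x < k then 0 else \<gamma>)"

definition LR_admissible ::
  "('s, 'p) stat_model \<Rightarrow> 'p set \<Rightarrow> 'p \<Rightarrow> 'p pmf \<Rightarrow> real \<Rightarrow> real \<Rightarrow> real \<Rightarrow> bool" where
  "LR_admissible M H0 h1 \<Lambda> \<alpha> k \<gamma> \<longleftrightarrow>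
     k \<ge> 0 \<and> \<gamma> \<in> {0..1} \<and>
     (\<Sum>h0\<in>H0. pmf \<Lambda> h0 * size_at M (threshold_test M H0 h1 \<Lambda> k \<gamma>) h0) = \<alpha>"

text \<open>
  The pair \<open>(k, \<gamma>)\<close> need not be unique. In a finite model satisfying \<open>ratio_positive\<close>, with
  \<open>\<Lambda>\<close> supported on \<open>H0\<close> and \<open>0 < \<alpha> < 1\<close>, an admissible pair exists and all admissible pairs
  give the same test on \<open>samples M\<close>, because two threshold tests are pointwise comparable and
  the mixture has full support. Hence the choice below is immaterial.
\<close>

definition LR_test ::
  "('s, 'p) stat_model \<Rightarrow> 'p set \<Rightarrow> 'p \<Rightarrow> 'p pmf \<Rightarrow> real \<Rightarrow> 's \<Rightarrow> real" where
  "LR_test M H0 h1 \<Lambda> \<alpha> =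
     (case (SOME (k, \<gamma>). LR_admissible M H0 h1 \<Lambda> \<alpha> k \<gamma>) of
        (k, \<gamma>) \<Rightarrow> threshold_test M H0 h1 \<Lambda> k \<gamma>)"

definition least_favorable ::
  "('s, 'p) stat_model \<Rightarrow> 'p set \<Rightarrow> 'p \<Rightarrow> real \<Rightarrow> 'p pmf \<Rightarrow> bool" where
  "least_favorable M H0 h1 \<alpha> \<Lambda> \<longleftrightarrow>
     set_pmf \<Lambda> \<subseteq> H0 \<and> most_powerful M H0 h1 \<alpha> (LR_test M H0 h1 \<Lambda> \<alpha>)"

definition uniformly_least_favorable ::
  "('s, 'p) stat_model \<Rightarrow> 'p set \<Rightarrow> 'p \<Rightarrow> 'p pmf \<Rightarrow> bool" where
  "uniformly_least_favorable M H0 h1 \<Lambda> \<longleftrightarrow>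
     (\<forall>\<alpha>. 0 < \<alpha> \<and> \<alpha> < 1 \<longrightarrow> least_favorable M H0 h1 \<alpha> \<Lambda>)"

end

theory Submission
  imports Defs
begin

text \<open>
  Let \<open>r\<close> be the likelihood ratio of \<open>h1\<close> to the \<open>\<Lambda>\<close>-mixture of the null hypothesis in the
  given model. Reading the size bound of the likelihood ratio test at every level \<open>\<alpha>\<close> at once
  turns uniform least favorability into a statement without levels: the law of \<open>r\<close> under any
  \<open>h0 \<in> H0\<close> is stochastically below its law under the mixture (\<open>null_stoch_le_mix\<close>). Its law
  under the mixture is in turn below its law under \<open>h1\<close>, because reweighting by \<open>r\<close> itself moves
  mass to large values of \<open>r\<close> (\<open>mix_stoch_le_alt\<close>).

  In the power model the mixture defined by \<open>Ext_pmf\<close> is the average over \<open>j\<close> of the product laws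
  \<open>one_null t j\<close>, whose \<open>j\<close>-th component follows the mixture and whose other components follow
  \<open>h1\<close>. Hence the likelihood ratio at \<open>x\<close> is the harmonic mean of the \<open>r (x j)\<close>
  (\<open>LRatio_power\<close>). It is increasing in each \<open>r (x j)\<close> and symmetric in the components, and so is
  each likelihood ratio test.

  A parameter vector in \<open>Ext_set\<close> has some component \<open>j\<close> in \<open>H0\<close>. Replacing that component by the
  mixture and all others by \<open>h1\<close> moves every component up in the stochastic order, and the test
  is increasing, so its size is at most its expectation under \<open>one_null t j\<close>
  (\<open>stoch_le_Pi_pmf_expectation\<close>, \<open>size_at_power_le_one_null\<close>). By symmetry this expectation does
  not depend on \<open>j\<close> (\<open>one_null_expectation_eq\<close>), and its average over \<open>j\<close> is \<open>\<alpha>\<close> by the choice of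
  the threshold. So the size is at most \<open>\<alpha>\<close> everywhere, which suffices for \<open>Ext_pmf\<close> to be
  least favorable by the Neyman-Pearson argument (\<open>least_favorable_iff\<close>).
\<close>

section \<open>Stochastic dominance along a statistic\<close>

definition stoch_le :: "('a \<Rightarrow> real) \<Rightarrow> 'a pmf \<Rightarrow> 'a pmf \<Rightarrow> bool" where
  "stoch_le r p q \<longleftrightarrow>
     (\<forall>k. measure_pmf.prob p {x. k \<le> r x} \<le> measure_pmf.prob q {x. k \<le> r x})"

lemma stoch_le_refl: "stoch_le r p p"
  by (simp add: stoch_le_def)

lemma stoch_le_trans: "stoch_le r p q \<Longrightarrow> stoch_le r q s \<Longrightarrow> stoch_le r p s"
  unfolding stoch_le_def by (meson order_trans)

abbreviation isotone_along :: "'a set \<Rightarrow> ('a \<Rightarrow> real) \<Rightarrow> ('a \<Rightarrow> real) \<Rightarrow> bool" where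
  "isotone_along S r \<equiv> monotone_on S (\<lambda>x y. r x \<le> r y) (\<le>)"

lemma expectation_finite_sum:
  fixes f :: "'a \<Rightarrow> real"
  assumes "finite S" "set_pmf p \<subseteq> S"
  shows "measure_pmf.expectation p f = (\<Sum>x\<in>S. f x * pmf p x)"
  using assms by (intro integral_measure_pmf_real) auto

lemma expectation_mono_on_support:
  fixes f g :: "'a \<Rightarrow> real"
  assumes "finite S" "set_pmf p \<subseteq> S" "\<And>x. x \<in> S \<Longrightarrow> f x \<le> g x"
  shows "measure_pmf.expectation p f \<le> measure_pmf.expectation p g"
  unfolding expectation_finite_sum[OF assms(1,2)]
  using assms(3) by (intro sum_mono mult_right_mono) auto

lemma expectation_cong_on_support:
  fixes f g :: "'a \<Rightarrow> real"
  assumes "finite S" "set_pmf p \<subseteq> S" "\<And>x. x \<in> S \<Longrightarrow> f x = g x"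
  shows "measure_pmf.expectation p f = measure_pmf.expectation p g"
  unfolding expectation_finite_sum[OF assms(1,2)]
  using assms(3) by (intro sum.cong) auto

text \<open>
  On a finite set an isotone function is a constant plus a nonnegative combination of indicators
  of upper sets \<open>{x. k \<le> r x}\<close>. The induction on the number of values peels these off from the top.
\<close>

lemma stoch_le_expectation:
  assumes "finite S" "set_pmf p \<subseteq> S" "set_pmf q \<subseteq> S" "stoch_le r p q"
    and "isotone_along S r g"
  shows "measure_pmf.expectation p g \<le> measure_pmf.expectation q g"
  using assms(5)
proof (induction "card (g ` S)" arbitrary: g rule: less_induct)
  case less
  note iso = monotone_onD[OF less.prems]
  have fin: "finite (g ` S)" using assms(1) by simp
  have ne: "S \<noteq> {}" using assms(2) set_pmf_not_empty[of p] by blast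
  define m where "m = Max (g ` S)"
  have m_in: "m \<in> g ` S" unfolding m_def using fin ne by (intro Max_in) auto
  have m_ge: "g x \<le> m" if "x \<in> S" for x unfolding m_def using fin that by simp
  show ?case
  proof (cases "g ` S = {m}")
    case True
    then have "g x = m" if "x \<in> S" for x using that by blast
    then have "measure_pmf.expectation s g = m" if "set_pmf s \<subseteq> S" for s
      using expectation_cong_on_support[OF assms(1) that, of g "\<lambda>_. m"] by simp
    then show ?thesis using assms(2,3) by simp
  next
    case False
    define l where "l = Max (g ` S - {m})"
    have l_in: "l \<in> g ` S - {m}" unfolding l_def
      using fin m_in False by (intro Max_in) auto
    have l_less: "l < m" using l_in m_ge by force
    have l_ge: "g x \<le> l" if "x \<in> S" "g x \<noteq> m" for x
      unfolding l_def using fin that by simp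
    define h where "h x = min (g x) l" for x
    define S1 where "S1 = {x\<in>S. g x = m}"
    define k where "k = Min (r ` S1)"
    have S1: "finite S1" "S1 \<noteq> {}" using assms(1) m_in by (auto simp: S1_def)
    \<comment> \<open>Capping \<open>g\<close> at its second largest value \<open>l\<close> removes one value; what is cut off is
        \<open>m - l\<close> times the indicator of the top level set, an upper set of the statistic.\<close>
    have top: "g x = m \<longleftrightarrow> k \<le> r x" if x: "x \<in> S" for x
    proof
      assume "g x = m"
      then show "k \<le> r x" unfolding k_def using S1 x by (simp add: S1_def)
    next
      assume kr: "k \<le> r x"
      have "k \<in> r ` S1" unfolding k_def using S1 by (intro Min_in) auto
      then obtain y where "y \<in> S" "g y = m" "k = r y" by (auto simp: S1_def)
      then show "g x = m" using iso[of y x] x kr m_ge[of x] by simp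
    qed
    have split: "measure_pmf.expectation s g =
        measure_pmf.expectation s h + (m - l) * measure_pmf.prob s {x. k \<le> r x}"
      if s: "set_pmf s \<subseteq> S" for s
    proof -
      have "measure_pmf.expectation s g =
          measure_pmf.expectation s (\<lambda>x. h x + (m - l) * indicator {x. k \<le> r x} x)"
      proof (rule expectation_cong_on_support[OF assms(1) s])
        fix x assume x: "x \<in> S"
        show "g x = h x + (m - l) * indicator {x. k \<le> r x} x"
          using top[OF x] l_ge[OF x] l_less by (auto simp: h_def indicator_def min_def)
      qed
      also have "\<dots> = measure_pmf.expectation s h + (m - l) * measure_pmf.prob s {x. k \<le> r x}"
        using finite_subset[OF s assms(1)]
        by (subst Bochner_Integration.integral_add) (auto intro: integrable_measure_pmf_finite)
      finally show ?thesis .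
    qed
    have "h ` S \<subseteq> g ` S - {m}"
      using l_in l_less l_ge by (auto simp: h_def min_def)
    then have "card (h ` S) < card (g ` S)"
      using m_in fin by (intro psubset_card_mono) auto
    moreover have "isotone_along S r h"
      using iso by (intro monotone_onI) (force simp: h_def min_def)
    ultimately have "measure_pmf.expectation p h \<le> measure_pmf.expectation q h"
      using less.hyps by blast
    moreover have "(m - l) * measure_pmf.prob p {x. k \<le> r x}
        \<le> (m - l) * measure_pmf.prob q {x. k \<le> r x}"
      using assms(4) l_less by (intro mult_left_mono) (auto simp: stoch_le_def)
    ultimately show ?thesis using split[OF assms(2)] split[OF assms(3)] by linarith
  qed
qed

section \<open>Dominance is inherited by products\<close>

lemma set_Pi_pmf_PiE:
  assumes "finite A" "\<And>i. i \<in> A \<Longrightarrow> set_pmf (p i) \<subseteq> S"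
  shows "set_pmf (Pi_pmf A undefined p) \<subseteq> A \<rightarrow>\<^sub>E S"
  using set_Pi_pmf_subset'[OF assms(1), of undefined p] assms(2)
  by (fastforce simp: PiE_dflt_def)

lemma fun_upd_insert_PiE: "a \<in> S \<Longrightarrow> b \<in> A \<rightarrow>\<^sub>E S \<Longrightarrow> b(j := a) \<in> insert j A \<rightarrow>\<^sub>E S"
  by (auto simp: PiE_def extensional_def)

lemma expectation_Pi_pmf_insert:
  fixes f :: "('i \<Rightarrow> 'a) \<Rightarrow> real"
  assumes "finite A" "j \<notin> A" "finite S" "\<And>i. i \<in> insert j A \<Longrightarrow> set_pmf (p i) \<subseteq> S"
  shows "measure_pmf.expectation (Pi_pmf (insert j A) undefined p) f =
     measure_pmf.expectation (Pi_pmf A undefined p)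
       (\<lambda>b. measure_pmf.expectation (p j) (\<lambda>a. f (b(j := a))))"
proof -
  have finA: "finite (A \<rightarrow>\<^sub>E S)" using assms(1,3) by (intro finite_PiE) auto
  have subA: "set_pmf (Pi_pmf A undefined p) \<subseteq> A \<rightarrow>\<^sub>E S"
    using assms(1,4) by (intro set_Pi_pmf_PiE) auto
  have "Pi_pmf (insert j A) undefined p =
      bind_pmf (Pi_pmf A undefined p) (\<lambda>b. map_pmf (\<lambda>a. b(j := a)) (p j))"
    unfolding Pi_pmf_insert'[OF assms(1,2)] map_pmf_def by (rule bind_commute_pmf)
  moreover have "finite (set_pmf (p j))"
    using assms(3,4) by (auto intro: finite_subset)
  ultimately show ?thesis
    by (simp add: pmf_expectation_bind[OF finA _ subA] expectation_finite_sum[OF finA subA]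
        mult.commute)
qed

text \<open>
  The coordinates are exchanged one at a time: with all others held fixed, the integrand is
  isotone along \<open>r\<close> in the exchanged one, and integrating a coordinate out keeps the integrand
  isotone in the rest.
\<close>

lemma stoch_le_Pi_pmf_expectation:
  fixes f :: "('i \<Rightarrow> 'a) \<Rightarrow> real"
  assumes "finite A" "finite S"
    and "\<And>i. i \<in> A \<Longrightarrow> set_pmf (p i) \<subseteq> S" "\<And>i. i \<in> A \<Longrightarrow> set_pmf (q i) \<subseteq> S"
    and "\<And>i. i \<in> A \<Longrightarrow> stoch_le r (p i) (q i)"
    and "monotone_on (A \<rightarrow>\<^sub>E S) (\<lambda>x y. \<forall>i\<in>A. r (x i) \<le> r (y i)) (\<le>) f"
  shows "measure_pmf.expectation (Pi_pmf A undefined p) f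
      \<le> measure_pmf.expectation (Pi_pmf A undefined q) f"
  using assms(1,3-)
proof (induction A arbitrary: f rule: finite_induct)
  case empty
  then show ?case by simp
next
  case (insert j A)
  note iso = monotone_onD[OF insert.prems(4)]
  have finA: "finite (A \<rightarrow>\<^sub>E S)" using insert.hyps assms(2) by (intro finite_PiE) auto
  have "measure_pmf.expectation (Pi_pmf (insert j A) undefined p) f =
      measure_pmf.expectation (Pi_pmf A undefined p)
        (\<lambda>b. measure_pmf.expectation (p j) (\<lambda>a. f (b(j := a))))"
    by (rule expectation_Pi_pmf_insert[OF insert.hyps assms(2) insert.prems(1)])
  also have "\<dots> \<le> measure_pmf.expectation (Pi_pmf A undefined p)
        (\<lambda>b. measure_pmf.expectation (q j) (\<lambda>a. f (b(j := a))))"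
  proof (rule expectation_mono_on_support[OF finA])
    show "set_pmf (Pi_pmf A undefined p) \<subseteq> A \<rightarrow>\<^sub>E S"
      using insert by (intro set_Pi_pmf_PiE) auto
    fix b assume b: "b \<in> A \<rightarrow>\<^sub>E S"
    have "isotone_along S r (\<lambda>a. f (b(j := a)))"
      using b by (intro monotone_onI iso fun_upd_insert_PiE) auto
    then show "measure_pmf.expectation (p j) (\<lambda>a. f (b(j := a)))
        \<le> measure_pmf.expectation (q j) (\<lambda>a. f (b(j := a)))"
      using insert.prems by (intro stoch_le_expectation[OF assms(2)]) auto
  qed
  also have "\<dots> \<le> measure_pmf.expectation (Pi_pmf A undefined q)
        (\<lambda>b. measure_pmf.expectation (q j) (\<lambda>a. f (b(j := a))))"
  proof (rule insert.IH)
    show "monotone_on (A \<rightarrow>\<^sub>E S) (\<lambda>x y. \<forall>i\<in>A. r (x i) \<le> r (y i)) (\<le>)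
        (\<lambda>b. measure_pmf.expectation (q j) (\<lambda>a. f (b(j := a))))"
      using insert.prems(2) insert.hyps
      by (intro monotone_onI expectation_mono_on_support[OF assms(2)] iso fun_upd_insert_PiE) auto
  qed (use insert.prems in auto)
  also have "\<dots> = measure_pmf.expectation (Pi_pmf (insert j A) undefined q) f"
    by (rule expectation_Pi_pmf_insert[OF insert.hyps assms(2) insert.prems(2), symmetric])
  finally show ?case .
qed

lemma Pi_pmf_permute:
  assumes "finite A" "\<tau> permutes A"
  shows "Pi_pmf A d (p \<circ> \<tau>) = map_pmf (\<lambda>x. x \<circ> \<tau>) (Pi_pmf A d p)"
proof (rule pmf_eqI)
  fix x :: "'a \<Rightarrow> 'b"
  have inv: "inv \<tau> permutes A" using assms(2) by (rule permutes_inv)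
  have x: "x = (x \<circ> inv \<tau>) \<circ> \<tau>" by (simp add: comp_assoc permutes_inv_o(2)[OF assms(2)])
  have "inj (\<lambda>x :: 'a \<Rightarrow> 'b. x \<circ> \<tau>)"
    using permutes_surj[OF assms(2)] by (simp add: fun.inj_map_strong inj_def) (metis surj_fun_eq)
  then have "pmf (map_pmf (\<lambda>x. x \<circ> \<tau>) (Pi_pmf A d p)) x = pmf (Pi_pmf A d p) (x \<circ> inv \<tau>)"
    by (subst x, subst pmf_map_inj') auto
  also have "\<dots> = pmf (Pi_pmf A d (p \<circ> \<tau>)) x"
  proof (cases "\<forall>i. i \<notin> A \<longrightarrow> x i = d")
    case True
    have "(\<Prod>i\<in>A. pmf (p i) (x (inv \<tau> i))) = (\<Prod>i\<in>A. pmf (p (\<tau> i)) (x i))"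
      using prod.permute[OF assms(2), of "\<lambda>i. pmf (p i) (x (inv \<tau> i))"]
      by (simp add: o_def permutes_inverses(2)[OF assms(2)])
    then show ?thesis using True assms(1) inv by (simp add: pmf_Pi permutes_not_in)
  next
    case False
    then show ?thesis using assms(1) inv by (auto simp: pmf_Pi permutes_not_in)
  qed
  finally show "pmf (Pi_pmf A d (p \<circ> \<tau>)) x = pmf (map_pmf (\<lambda>x. x \<circ> \<tau>) (Pi_pmf A d p)) x"
    by simp
qed

text \<open>
  A product law is linear in each factor, so averaging over one component of the parameter vector
  amounts to taking the mixture in that component.
\<close>

lemma Pi_pmf_bind_component:
  assumes "finite A" "j \<in> A"
  shows "bind_pmf L (\<lambda>\<theta>. Pi_pmf A d (c(j := D \<theta>))) = Pi_pmf A d (c(j := bind_pmf L D))"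
proof -
  have A: "A = insert j (A - {j})" using assms(2) by blast
  have "Pi_pmf A d (c(j := u)) =
      bind_pmf u (\<lambda>y. map_pmf (\<lambda>f. f(j := y)) (Pi_pmf (A - {j}) d c))" for u
  proof -
    have "Pi_pmf (A - {j}) d (c(j := u)) = Pi_pmf (A - {j}) d c" by (rule Pi_pmf_cong) auto
    then show ?thesis
      by (subst A, subst Pi_pmf_insert') (use assms(1) in \<open>auto simp: map_pmf_def\<close>)
  qed
  then show ?thesis by (simp add: bind_assoc_pmf)
qed


section \<open>Least favorable distributions in a finite model\<close>

lemma mixture_eq_pmf_bind:
  assumes "finite H0" "set_pmf \<Lambda> \<subseteq> H0"
  shows "mixture M H0 \<Lambda> x = pmf (bind_pmf \<Lambda> (dist M)) x"
  unfolding mixture_def pmf_bind expectation_finite_sum[OF assms] by (simp add: mult.commute)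

locale testing_problem =
  fixes M :: "('s, 'p) stat_model" and H0 :: "'p set" and h1 :: 'p and \<Lambda> :: "'p pmf"
  assumes finite_model: "finite_stat_model M"
    and null_params: "H0 \<subseteq> params M"
    and alt_param: "h1 \<in> params M"
    and prior_support: "set_pmf \<Lambda> \<subseteq> H0"
    and ratio_positive: "ratio_positive M H0 h1 \<Lambda>"
begin

abbreviation S :: "'s set" where "S \<equiv> samples M"
abbreviation r :: "'s \<Rightarrow> real" where "r \<equiv> LRatio M H0 h1 \<Lambda>"

definition mix :: "'s pmf" where "mix = bind_pmf \<Lambda> (dist M)"

lemma finite_samples: "finite S"
  using finite_model by (simp add: finite_stat_model_def)

lemma finite_null: "finite H0"
  using finite_model null_params finite_subset by (auto simp: finite_stat_model_def)

lemma null_nonempty: "H0 \<noteq> {}"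
  using prior_support set_pmf_not_empty[of \<Lambda>] by blast

lemma set_dist: "h \<in> params M \<Longrightarrow> set_pmf (dist M h) \<subseteq> S"
  using finite_model by (simp add: finite_stat_model_def stat_model_def)

lemma set_null: "h \<in> H0 \<Longrightarrow> set_pmf (dist M h) \<subseteq> S"
  using set_dist null_params by blast

lemma set_alt: "set_pmf (dist M h1) \<subseteq> S"
  using set_dist alt_param .

lemma set_mix: "set_pmf mix \<subseteq> S"
  using set_null prior_support by (auto simp: mix_def)

lemma pmf_mix: "pmf mix x = mixture M H0 \<Lambda> x"
  by (simp add: mix_def mixture_eq_pmf_bind[OF finite_null prior_support])

lemma mean_size: "(\<Sum>h\<in>H0. pmf \<Lambda> h * size_at M f h) = measure_pmf.expectation mix f"
  unfolding mix_def size_at_def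
  using pmf_expectation_bind[OF finite_null _ prior_support, of "dist M" f]
    finite_subset[OF set_null finite_samples] by simp

lemma mix_pos: "x \<in> S \<Longrightarrow> 0 < pmf mix x"
  using ratio_positive by (simp add: pmf_mix ratio_positive_def)

lemma r_pos: "x \<in> S \<Longrightarrow> 0 < r x"
  using ratio_positive by (simp add: LRatio_def ratio_positive_def)

lemma pmf_alt: "x \<in> S \<Longrightarrow> pmf (dist M h1) x = r x * pmf mix x"
  using mix_pos[of x] by (simp add: LRatio_def pmf_mix)

lemma prob_finite_sum:
  "set_pmf p \<subseteq> S \<Longrightarrow> measure_pmf.prob p {x. P x} = (\<Sum>x\<in>{x\<in>S. P x}. pmf p x)"
proof -
  assume p: "set_pmf p \<subseteq> S"
  have "measure_pmf.prob p {x. P x} = measure_pmf.prob p ({x. P x} \<inter> S)"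
    using p by (intro measure_prob_cong_0) (auto simp: pmf_eq_0_set_pmf)
  also have "{x. P x} \<inter> S = {x\<in>S. P x}" by blast
  finally show ?thesis by (simp add: measure_measure_pmf_finite finite_samples)
qed

lemma threshold_expectation:
  assumes "set_pmf p \<subseteq> S"
  shows "measure_pmf.expectation p (threshold_test M H0 h1 \<Lambda> k \<gamma>) =
    measure_pmf.prob p {x. k < r x} + \<gamma> * measure_pmf.prob p {x. r x = k}"
proof -
  have "threshold_test M H0 h1 \<Lambda> k \<gamma> =
      (\<lambda>x. indicator {x. k < r x} x + \<gamma> * indicator {x. r x = k} x)"
    by (rule ext) (auto simp: threshold_test_def)
  then show ?thesis
    using finite_subset[OF assms finite_samples]
    by (simp add: Bochner_Integration.integral_add integrable_measure_pmf_finite)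
qed

lemma threshold_test_isotone:
  "0 \<le> \<gamma> \<Longrightarrow> \<gamma> \<le> 1 \<Longrightarrow> r x \<le> r y \<Longrightarrow>
    threshold_test M H0 h1 \<Lambda> k \<gamma> x \<le> threshold_test M H0 h1 \<Lambda> k \<gamma> y"
  by (auto simp: threshold_test_def)

text \<open>
  The threshold is the largest value \<open>k\<close> of the ratio that is still reached with mixture
  probability at least \<open>\<alpha>\<close>. Exceeding \<open>k\<close> then has probability at most \<open>\<alpha>\<close>, and randomizing on
  the atom at \<open>k\<close> supplies the missing mass.
\<close>

lemma LR_admissible_exists:
  assumes "0 < \<alpha>" "\<alpha> < 1"
  shows "\<exists>k \<gamma>. LR_admissible M H0 h1 \<Lambda> \<alpha> k \<gamma>"
proof -
  define K where "K = {v \<in> r ` S. \<alpha> \<le> measure_pmf.prob mix {x. v \<le> r x}}"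
  have finr: "finite (r ` S)" using finite_samples by simp
  have "S \<noteq> {}" using set_mix set_pmf_not_empty[of mix] by blast
  then have ner: "r ` S \<noteq> {}" by simp
  have "measure_pmf.prob mix {x. Min (r ` S) \<le> r x} = 1"
    using set_mix finr by (subst measure_pmf.prob_eq_1) (auto simp: AE_measure_pmf_iff)
  then have "Min (r ` S) \<in> K"
    using Min_in[OF finr ner] assms(2) unfolding K_def by (simp del: Min_in)
  then have K: "finite K" "K \<noteq> {}" using finr by (auto simp: K_def)
  define k where "k = Max K"
  have kK: "k \<in> K" unfolding k_def using K by (rule Max_in)
  define a where "a = measure_pmf.prob mix {x. k < r x}"
  define b where "b = measure_pmf.prob mix {x. r x = k}"
  have ab: "\<alpha> \<le> a + b"
  proof -
    have "{x. k \<le> r x} = {x. k < r x} \<union> {x. r x = k}" by auto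
    then have "measure_pmf.prob mix {x. k \<le> r x} = a + b"
      unfolding a_def b_def by (simp add: measure_pmf.finite_measure_Union disjoint_iff)
    then show ?thesis using kK by (simp add: K_def)
  qed
  \<comment> \<open>Otherwise the next larger value of the ratio would be reached with probability \<open>a\<close>,
      against the maximality of \<open>k\<close>.\<close>
  have a_le: "a \<le> \<alpha>"
  proof (rule ccontr)
    assume "\<not> a \<le> \<alpha>"
    then have gt: "\<alpha> < a" by simp
    define V where "V = {v \<in> r ` S. k < v}"
    have "V \<noteq> {}"
    proof
      assume "V = {}"
      then have "{x\<in>S. k < r x} = {}" by (auto simp: V_def)
      then have "a = 0" unfolding a_def prob_finite_sum[OF set_mix] by (simp only: sum.empty)
      then show False using gt assms(1) by simp
    qed
    moreover have "finite V" using finr by (simp add: V_def)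
    ultimately have v: "Min V \<in> V" and V_min: "\<And>u. u \<in> V \<Longrightarrow> Min V \<le> u"
      by auto
    have eq: "{x\<in>S. k < r x} = {x\<in>S. Min V \<le> r x}"
      using v V_min unfolding V_def by force
    have "a = measure_pmf.prob mix {x. Min V \<le> r x}"
      unfolding a_def prob_finite_sum[OF set_mix] eq ..
    then have "Min V \<in> K" using v gt by (simp add: K_def V_def)
    then have "Min V \<le> k" unfolding k_def using K by simp
    then show False using v by (simp add: V_def)
  qed
  have "k \<in> r ` S" using kK by (simp add: K_def)
  then obtain x where x: "x \<in> S" "r x = k" by blast
  then have "x \<in> set_pmf mix" using mix_pos by (metis less_irrefl pmf_eq_0_set_pmf)
  then have b_pos: "0 < b" unfolding b_def
    using x(2) by (intro measure_pmf_posI[of x]) auto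
  have "k \<ge> 0" using r_pos[OF x(1)] x(2) by simp
  moreover have "(\<alpha> - a) / b \<in> {0..1}" using a_le ab b_pos by (auto simp: field_simps)
  moreover have "measure_pmf.expectation mix (threshold_test M H0 h1 \<Lambda> k ((\<alpha> - a) / b)) = \<alpha>"
    unfolding threshold_expectation[OF set_mix] using b_pos by (simp flip: a_def b_def)
  ultimately show ?thesis unfolding LR_admissible_def mean_size by blast
qed

lemma LR_test_is_threshold_test:
  assumes "0 < \<alpha>" "\<alpha> < 1"
  obtains k \<gamma> where "k \<ge> 0" "0 \<le> \<gamma>" "\<gamma> \<le> 1"
    and "LR_test M H0 h1 \<Lambda> \<alpha> = threshold_test M H0 h1 \<Lambda> k \<gamma>"
    and "measure_pmf.expectation mix (LR_test M H0 h1 \<Lambda> \<alpha>) = \<alpha>"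
proof -
  obtain k \<gamma> where eq: "(SOME (k, \<gamma>). LR_admissible M H0 h1 \<Lambda> \<alpha> k \<gamma>) = (k, \<gamma>)"
    by (rule prod.exhaust)
  have "case (SOME (k, \<gamma>). LR_admissible M H0 h1 \<Lambda> \<alpha> k \<gamma>) of
      (k, \<gamma>) \<Rightarrow> LR_admissible M H0 h1 \<Lambda> \<alpha> k \<gamma>"
    by (rule someI_ex) (use LR_admissible_exists[OF assms] in auto)
  then have "LR_admissible M H0 h1 \<Lambda> \<alpha> k \<gamma>" unfolding eq by simp
  moreover have "LR_test M H0 h1 \<Lambda> \<alpha> = threshold_test M H0 h1 \<Lambda> k \<gamma>"
    unfolding LR_test_def eq by simp
  ultimately show thesis
    using that[of k \<gamma>] unfolding LR_admissible_def mean_size by simp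
qed

lemma size_le_test_size: "h \<in> H0 \<Longrightarrow> size_at M f h \<le> test_size M H0 f"
  unfolding test_size_def by (intro cSUP_upper bdd_above_finite) (auto simp: finite_null)

lemma mean_size_le:
  assumes "\<And>h. h \<in> H0 \<Longrightarrow> size_at M f h \<le> \<alpha>"
  shows "measure_pmf.expectation mix f \<le> \<alpha>"
proof -
  have "(\<Sum>h\<in>H0. pmf \<Lambda> h * size_at M f h) \<le> (\<Sum>h\<in>H0. pmf \<Lambda> h * \<alpha>)"
    using assms by (intro sum_mono mult_left_mono) auto
  also have "\<dots> = \<alpha>"
    using sum_pmf_eq_1[OF finite_null prior_support] by (simp flip: sum_distrib_right)
  finally show ?thesis by (simp only: mean_size)
qed

text \<open>
  The Neyman-Pearson lemma for the mixture against \<open>h1\<close>: as the threshold test \<open>f\<close> is 1 where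
  \<open>r > k\<close> and 0 where \<open>r < k\<close>, the product \<open>(f - g) (r - k)\<close> is nonnegative, and its mixture
  expectation compares the gain in power with \<open>k\<close> times the change in mean size.
\<close>

lemma threshold_test_optimal:
  assumes "k \<ge> 0" "0 \<le> \<gamma>" "\<gamma> \<le> 1" "is_test M g"
    and "measure_pmf.expectation mix g
      \<le> measure_pmf.expectation mix (threshold_test M H0 h1 \<Lambda> k \<gamma>)"
  shows "test_power M g h1 \<le> test_power M (threshold_test M H0 h1 \<Lambda> k \<gamma>) h1"
proof -
  let ?f = "threshold_test M H0 h1 \<Lambda> k \<gamma>"
  have "0 \<le> (\<Sum>x\<in>S. (?f x - g x) * (r x - k) * pmf mix x)"
  proof (rule sum_nonneg)
    fix x assume "x \<in> S"
    then have "0 \<le> g x" "g x \<le> 1" using assms(4) by (auto simp: is_test_def Pi_def)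
    then have "0 \<le> (?f x - g x) * (r x - k)"
      by (auto simp: threshold_test_def zero_le_mult_iff)
    then show "0 \<le> (?f x - g x) * (r x - k) * pmf mix x" by simp
  qed
  also have "\<dots> = (\<Sum>x\<in>S. (?f x * pmf (dist M h1) x - g x * pmf (dist M h1) x)
      - k * (?f x * pmf mix x - g x * pmf mix x))"
    by (intro sum.cong refl) (simp add: pmf_alt algebra_simps)
  also have "\<dots> = (test_power M ?f h1 - test_power M g h1)
      - k * (measure_pmf.expectation mix ?f - measure_pmf.expectation mix g)"
    unfolding test_power_def expectation_finite_sum[OF finite_samples set_alt]
      expectation_finite_sum[OF finite_samples set_mix]
    by (simp add: sum_subtractf flip: sum_distrib_left)
  finally show ?thesis
    using mult_nonneg_nonneg[OF assms(1), of
      "measure_pmf.expectation mix ?f - measure_pmf.expectation mix g"] assms(5) by simp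
qed

text \<open>
  Only the upper bound on the sizes has to be checked: the mean size under \<open>\<Lambda>\<close> is \<open>\<alpha>\<close> by the choice
  of the threshold, so the supremum cannot be smaller, and any competitor of size at most \<open>\<alpha>\<close>
  also has mean size at most \<open>\<alpha>\<close> and thus loses to the threshold test.
\<close>

lemma least_favorable_iff:
  assumes "0 < \<alpha>" "\<alpha> < 1"
  shows "least_favorable M H0 h1 \<alpha> \<Lambda> \<longleftrightarrow>
    (\<forall>h\<in>H0. size_at M (LR_test M H0 h1 \<Lambda> \<alpha>) h \<le> \<alpha>)"
proof
  assume "least_favorable M H0 h1 \<alpha> \<Lambda>"
  then show "\<forall>h\<in>H0. size_at M (LR_test M H0 h1 \<Lambda> \<alpha>) h \<le> \<alpha>"
    using size_le_test_size[of _ "LR_test M H0 h1 \<Lambda> \<alpha>"]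
    by (simp add: least_favorable_def most_powerful_def)
next
  let ?f = "LR_test M H0 h1 \<Lambda> \<alpha>"
  assume le: "\<forall>h\<in>H0. size_at M ?f h \<le> \<alpha>"
  obtain k \<gamma> where k: "k \<ge> 0" "0 \<le> \<gamma>" "\<gamma> \<le> 1"
    and f: "?f = threshold_test M H0 h1 \<Lambda> k \<gamma>" and mean: "measure_pmf.expectation mix ?f = \<alpha>"
    using LR_test_is_threshold_test[OF assms] .
  have "test_size M H0 ?f \<le> \<alpha>"
    unfolding test_size_def using le null_nonempty by (intro cSUP_least) auto
  moreover have "\<alpha> \<le> test_size M H0 ?f"
    using mean_size_le[OF size_le_test_size, of ?f] mean by simp
  moreover have "is_test M ?f" using k by (auto simp: f is_test_def threshold_test_def)
  moreover have "test_power M g h1 \<le> test_power M ?f h1"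
    if "is_test M g" "test_size M H0 g \<le> \<alpha>" for g
  proof -
    have "measure_pmf.expectation mix g \<le> measure_pmf.expectation mix ?f"
      unfolding mean by (intro mean_size_le order_trans[OF size_le_test_size that(2)])
    then show ?thesis
      using threshold_test_optimal[OF k that(1)] by (simp add: f)
  qed
  ultimately show "least_favorable M H0 h1 \<alpha> \<Lambda>"
    using prior_support by (simp add: least_favorable_def most_powerful_def)
qed

text \<open>
  The test that rejects exactly if \<open>c \<le> r x\<close> is the likelihood ratio test of the level
  \<open>\<alpha>\<close> that it attains under the mixture. The size bound at this level is the required
  inequality of tail probabilities. At the excluded levels 0 and 1 the inequality is trivial.
\<close>

lemma null_stoch_le_mix:
  assumes "uniformly_least_favorable M H0 h1 \<Lambda>" "h \<in> H0"
  shows "stoch_le r (dist M h) mix"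
  unfolding stoch_le_def
proof
  fix c
  define \<alpha> where "\<alpha> = measure_pmf.prob mix {x. c \<le> r x}"
  consider "\<alpha> = 0" | "\<alpha> = 1" | "0 < \<alpha>" "\<alpha> < 1"
    using measure_pmf.prob_le_1[of mix "{x. c \<le> r x}"]
    by (metis \<alpha>_def measure_nonneg order_less_le)
  then show "measure_pmf.prob (dist M h) {x. c \<le> r x} \<le> measure_pmf.prob mix {x. c \<le> r x}"
  proof cases
    case 1
    then have "pmf mix x = 0" if "x \<in> S" "c \<le> r x" for x
      using that finite_samples
      by (simp add: \<alpha>_def prob_finite_sum[OF set_mix] sum_nonneg_eq_0_iff)
    then have "{x\<in>S. c \<le> r x} = {}" using mix_pos by force
    then show ?thesis
      unfolding prob_finite_sum[OF set_null[OF assms(2)]] by (simp only: sum.empty) simp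
  next
    case 2
    then show ?thesis by (simp flip: \<alpha>_def)
  next
    case 3
    let ?f = "LR_test M H0 h1 \<Lambda> \<alpha>" and ?g = "indicator {x. c \<le> r x} :: 's \<Rightarrow> real"
    obtain k \<gamma> where k: "k \<ge> 0" "0 \<le> \<gamma>" "\<gamma> \<le> 1"
      and f: "?f = threshold_test M H0 h1 \<Lambda> k \<gamma>" and mean: "measure_pmf.expectation mix ?f = \<alpha>"
      using LR_test_is_threshold_test[OF 3] .
    have mean_eq: "(\<Sum>x\<in>S. ?f x * pmf mix x) = (\<Sum>x\<in>S. ?g x * pmf mix x)"
      using mean by (simp add: \<alpha>_def flip: expectation_finite_sum[OF finite_samples set_mix])
    \<comment> \<open>Tests that reject for large ratios are pointwise comparable; as the mixture
        charges every sample, equal mean size forces them to coincide.\<close>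
    have same: "?f x = ?g x" if "x \<in> S" for x
    proof (cases "k < c")
      case True
      then have "?g y * pmf mix y \<le> ?f y * pmf mix y" for y
        using k by (intro mult_right_mono) (auto simp: f threshold_test_def indicator_def)
      then have "?g x * pmf mix x = ?f x * pmf mix x"
        using sum_mono_inv[OF mean_eq[symmetric] _ that finite_samples] by blast
      then show ?thesis using mix_pos[OF that] by simp
    next
      case False
      then have "?f y * pmf mix y \<le> ?g y * pmf mix y" for y
        using k by (intro mult_right_mono) (auto simp: f threshold_test_def indicator_def)
      then have "?f x * pmf mix x = ?g x * pmf mix x"
        using sum_mono_inv[OF mean_eq _ that finite_samples] by blast
      then show ?thesis using mix_pos[OF that] by simp
    qed
    have "measure_pmf.prob (dist M h) {x. c \<le> r x} = measure_pmf.expectation (dist M h) ?g"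
      by simp
    also have "\<dots> = size_at M ?f h"
      unfolding size_at_def
      by (intro expectation_cong_on_support[OF finite_samples set_null[OF assms(2)]] same[symmetric])
    also have "\<dots> \<le> \<alpha>"
      using assms 3 least_favorable_iff[OF 3] by (simp add: uniformly_least_favorable_def)
    finally show ?thesis by (simp add: \<alpha>_def)
  qed
qed

text \<open>
  As \<open>r\<close> is the density of \<open>h1\<close> with respect to the mixture, passing to \<open>h1\<close> adds mass wherever
  \<open>1 \<le> r\<close> and removes mass elsewhere. For \<open>c \<ge> 1\<close> this is applied to the tail, and for \<open>c < 1\<close>
  to its complement.
\<close>

lemma mix_stoch_le_alt: "stoch_le r mix (dist M h1)"
  unfolding stoch_le_def
proof
  fix c
  show "measure_pmf.prob mix {x. c \<le> r x} \<le> measure_pmf.prob (dist M h1) {x. c \<le> r x}"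
  proof (cases "1 \<le> c")
    case True
    then show ?thesis
      unfolding prob_finite_sum[OF set_mix] prob_finite_sum[OF set_alt]
      by (intro sum_mono) (simp add: pmf_alt mult_le_cancel_right1)
  next
    case False
    have "measure_pmf.prob (dist M h1) {x. r x < c} \<le> measure_pmf.prob mix {x. r x < c}"
      using False unfolding prob_finite_sum[OF set_mix] prob_finite_sum[OF set_alt]
      by (intro sum_mono) (simp add: pmf_alt mult_le_cancel_right2)
    moreover have "measure_pmf.prob p {x. c \<le> r x} = 1 - measure_pmf.prob p {x. r x < c}" for p
      using measure_pmf.prob_compl[of "{x. r x < c}" p]
      by (simp add: Compl_eq_Diff_UNIV[symmetric] Collect_neg_eq[symmetric] not_less)
    ultimately show ?thesis by simp
  qed
qed


section \<open>The power model\<close>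

definition one_null :: "nat \<Rightarrow> nat \<Rightarrow> (nat \<Rightarrow> 's) pmf" where
  "one_null t j = Pi_pmf {1..t} undefined ((\<lambda>_. dist M h1)(j := mix))"

lemma set_one_null: "set_pmf (one_null t j) \<subseteq> {1..t} \<rightarrow>\<^sub>E S"
  unfolding one_null_def using set_alt set_mix by (intro set_Pi_pmf_PiE) auto

lemma finite_vectors: "finite ({1..t::nat} \<rightarrow>\<^sub>E S)"
  using finite_samples by (intro finite_PiE) auto

lemma dist_power_alt:
  "dist (model_power M t) (const_vec h1 t) = Pi_pmf {1..t} undefined (\<lambda>_. dist M h1)"
  unfolding model_power_def stat_model.simps by (rule Pi_pmf_cong) (auto simp: const_vec_def)

text \<open>
  For a fixed position \<open>j\<close>, drawing the deviating parameter from \<open>\<Lambda>\<close> mixes only the factor at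
  \<open>j\<close>. The law obtained here has the denominator of the ratio in the power model as its mass
  function.
\<close>

lemma Ext_mix_eq:
  assumes "t \<ge> 1"
  shows "bind_pmf (Ext_pmf \<Lambda> h1 t) (dist (model_power M t)) =
    bind_pmf (pmf_of_set {1..t}) (one_null t)"
proof -
  have "bind_pmf \<Lambda> (\<lambda>\<theta>. dist (model_power M t) ((const_vec h1 t)(j := \<theta>))) = one_null t j"
    if j: "j \<in> {1..t}" for j
  proof -
    have "dist (model_power M t) ((const_vec h1 t)(j := \<theta>)) =
        Pi_pmf {1..t} undefined ((\<lambda>_. dist M h1)(j := dist M \<theta>))" for \<theta>
      unfolding model_power_def stat_model.simps by (rule Pi_pmf_cong) (auto simp: const_vec_def)
    then show ?thesis
      using Pi_pmf_bind_component[OF _ j] by (simp add: one_null_def mix_def)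
  qed
  then show ?thesis
    using assms by (auto simp: Ext_pmf_def bind_assoc_pmf bind_map_pmf intro!: bind_pmf_cong)
qed

lemma pmf_one_null:
  assumes "j \<in> {1..t}" "x \<in> {1..t} \<rightarrow>\<^sub>E S"
  shows "pmf (one_null t j) x = pmf (dist (model_power M t) (const_vec h1 t)) x / r (x j)"
proof -
  have x: "x i \<in> S" if "i \<in> {1..t}" for i using assms(2) that by auto
  have out: "\<forall>i. i \<notin> {1..t} \<longrightarrow> x i = undefined"
    using assms(2) by (auto simp: PiE_def extensional_def)
  have "(\<Prod>i\<in>{1..t}. pmf (((\<lambda>_. dist M h1)(j := mix)) i) (x i)) =
      pmf mix (x j) * (\<Prod>i\<in>{1..t} - {j}. pmf (dist M h1) (x i))"
    using assms(1) by (subst prod.remove[of _ j]) auto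
  also have "\<dots> = (\<Prod>i\<in>{1..t}. pmf (dist M h1) (x i)) / r (x j)"
    using assms(1) pmf_alt[OF x[OF assms(1)]] r_pos[OF x[OF assms(1)]]
    by (subst prod.remove[of "{1..t}" j]) auto
  finally show ?thesis
    unfolding dist_power_alt one_null_def using out by (simp add: pmf_Pi)
qed

lemma pmf_alt_power_pos:
  assumes "x \<in> {1..t} \<rightarrow>\<^sub>E S"
  shows "0 < pmf (dist (model_power M t) (const_vec h1 t)) x"
proof -
  have "0 < pmf (dist M h1) (x i)" if "i \<in> {1..t}" for i
    using that assms ratio_positive by (auto simp: ratio_positive_def)
  then have "0 < (\<Prod>i\<in>{1..t}. pmf (dist M h1) (x i))" by (intro prod_pos) auto
  then show ?thesis
    unfolding dist_power_alt using assms by (subst pmf_Pi) (auto simp: PiE_def extensional_def)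
qed

lemma ratio_component_pos: "x \<in> {1..t::nat} \<rightarrow>\<^sub>E S \<Longrightarrow> i \<in> {1..t} \<Longrightarrow> 0 < r (x i)"
  by (rule r_pos) (rule PiE_mem)

lemma sum_inverse_ratio_pos:
  assumes "t \<ge> 1" "x \<in> {1..t::nat} \<rightarrow>\<^sub>E S"
  shows "0 < (\<Sum>j\<in>{1..t}. 1 / r (x j))"
  using assms(1) ratio_component_pos[OF assms(2)] by (intro sum_pos) auto

lemma set_Ext_pmf:
  assumes "t \<ge> 1" "h1 \<notin> H0"
  shows "set_pmf (Ext_pmf \<Lambda> h1 t) \<subseteq> Ext_set H0 h1 t"
proof
  fix v assume "v \<in> set_pmf (Ext_pmf \<Lambda> h1 t)"
  then obtain j \<theta> where j: "j \<in> {1..t}" and \<theta>: "\<theta> \<in> set_pmf \<Lambda>"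
    and v: "v = (const_vec h1 t)(j := \<theta>)"
    using assms(1) by (auto simp: Ext_pmf_def)
  have "\<theta> \<in> H0" using \<theta> prior_support by blast
  then have "v j \<noteq> const_vec h1 t j" using v j assms(2) by (auto simp: const_vec_def)
  then have "v \<noteq> const_vec h1 t" by auto
  then show "v \<in> Ext_set H0 h1 t"
    using j \<open>\<theta> \<in> H0\<close> by (auto simp: Ext_set_def v const_vec_def)
qed

lemma finite_power_model: "finite_stat_model (model_power M t)"
proof -
  have "set_pmf (Pi_pmf {1..t} undefined (\<lambda>j. dist M (\<theta> j))) \<subseteq> {1..t} \<rightarrow>\<^sub>E S"
    if "\<theta> \<in> {1..t} \<rightarrow>\<^sub>E params M" for \<theta>
    using that by (intro set_Pi_pmf_PiE set_dist) auto
  then show ?thesis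
    using finite_model
    by (auto simp: finite_stat_model_def stat_model_def model_power_def intro!: finite_PiE)
qed

lemma Ext_set_subset: "Ext_set H0 h1 t \<subseteq> {1..t} \<rightarrow>\<^sub>E params M"
  unfolding Ext_set_def using null_params alt_param
  by (intro Diff_subset[THEN subset_trans] PiE_mono) auto

lemma mixture_power:
  assumes "t \<ge> 1" "h1 \<notin> H0" "x \<in> {1..t} \<rightarrow>\<^sub>E S"
  shows "mixture (model_power M t) (Ext_set H0 h1 t) (Ext_pmf \<Lambda> h1 t) x =
    pmf (dist (model_power M t) (const_vec h1 t)) x * (\<Sum>j\<in>{1..t}. 1 / r (x j)) / real t"
proof -
  have "finite (Ext_set H0 h1 t)"
    by (rule finite_subset[OF Ext_set_subset])
      (use finite_model in \<open>auto simp: finite_stat_model_def intro!: finite_PiE\<close>)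
  then have "mixture (model_power M t) (Ext_set H0 h1 t) (Ext_pmf \<Lambda> h1 t) x =
      (\<Sum>j\<in>{1..t}. pmf (one_null t j) x) / real t"
    using assms(1)
    by (simp add: mixture_eq_pmf_bind set_Ext_pmf[OF assms(1,2)] Ext_mix_eq pmf_bind_pmf_of_set)
  then show ?thesis
    using pmf_one_null[OF _ assms(3)] by (simp add: sum_distrib_left)
qed

abbreviation power_ratio :: "nat \<Rightarrow> (nat \<Rightarrow> 's) \<Rightarrow> real" where
  "power_ratio t \<equiv>
    LRatio (model_power M t) (Ext_set H0 h1 t) (const_vec h1 t) (Ext_pmf \<Lambda> h1 t)"

lemma LRatio_power:
  assumes "t \<ge> 1" "h1 \<notin> H0" "x \<in> {1..t} \<rightarrow>\<^sub>E S"
  shows "power_ratio t x =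
    real t / (\<Sum>j\<in>{1..t}. 1 / r (x j))"
  using pmf_alt_power_pos[OF assms(3)] by (simp add: LRatio_def mixture_power[OF assms])

lemma testing_problem_power:
  assumes "t \<ge> 1" "h1 \<notin> H0"
  shows "testing_problem (model_power M t) (Ext_set H0 h1 t) (const_vec h1 t) (Ext_pmf \<Lambda> h1 t)"
proof
  show "finite_stat_model (model_power M t)" by (rule finite_power_model)
  show "Ext_set H0 h1 t \<subseteq> params (model_power M t)"
    using Ext_set_subset by (simp add: model_power_def)
  show "const_vec h1 t \<in> params (model_power M t)"
    using alt_param by (auto simp: model_power_def const_vec_def)
  show "set_pmf (Ext_pmf \<Lambda> h1 t) \<subseteq> Ext_set H0 h1 t" by (rule set_Ext_pmf[OF assms])
  show "ratio_positive (model_power M t) (Ext_set H0 h1 t) (const_vec h1 t) (Ext_pmf \<Lambda> h1 t)"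
    unfolding ratio_positive_def
  proof
    fix x assume "x \<in> samples (model_power M t)"
    then have x: "x \<in> {1..t} \<rightarrow>\<^sub>E S" by (simp add: model_power_def)
    show "0 < pmf (dist (model_power M t) (const_vec h1 t)) x \<and>
        0 < mixture (model_power M t) (Ext_set H0 h1 t) (Ext_pmf \<Lambda> h1 t) x"
      unfolding mixture_power[OF assms x]
      using pmf_alt_power_pos[OF x] sum_inverse_ratio_pos[OF assms(1) x] assms(1) by simp
  qed
qed

text \<open>
  The next two properties of the harmonic mean are all that the size bound uses about the ratio of
  the power model.
\<close>

lemma LRatio_power_mono:
  assumes "t \<ge> 1" "h1 \<notin> H0" "x \<in> {1..t} \<rightarrow>\<^sub>E S" "y \<in> {1..t} \<rightarrow>\<^sub>E S"
    and "\<forall>i\<in>{1..t}. r (x i) \<le> r (y i)"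
  shows "power_ratio t x
    \<le> power_ratio t y"
proof -
  have "(\<Sum>j\<in>{1..t}. 1 / r (y j)) \<le> (\<Sum>j\<in>{1..t}. 1 / r (x j))"
    using assms(5) ratio_component_pos[OF assms(3)] ratio_component_pos[OF assms(4)]
    by (intro sum_mono divide_left_mono mult_pos_pos) auto
  then show ?thesis
    unfolding LRatio_power[OF assms(1-3)] LRatio_power[OF assms(1,2,4)]
    using sum_inverse_ratio_pos[OF assms(1,3)] sum_inverse_ratio_pos[OF assms(1,4)]
    by (intro divide_left_mono mult_pos_pos) auto
qed

lemma LRatio_power_permute:
  assumes "t \<ge> 1" "h1 \<notin> H0" "\<tau> permutes {1..t}" "x \<in> {1..t} \<rightarrow>\<^sub>E S"
  shows "power_ratio t (x \<circ> \<tau>)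
    = power_ratio t x"
proof -
  have "x \<circ> \<tau> \<in> {1..t} \<rightarrow>\<^sub>E S"
  proof (rule PiE_I)
    show "(x \<circ> \<tau>) i \<in> S" if "i \<in> {1..t}" for i
      using PiE_mem[OF assms(4)] permutes_in_image[OF assms(3)] that by simp
    show "(x \<circ> \<tau>) i = undefined" if "i \<notin> {1..t}" for i
      using PiE_arb[OF assms(4) that] permutes_not_in[OF assms(3) that] by simp
  qed
  moreover have "(\<Sum>j\<in>{1..t}. 1 / r ((x \<circ> \<tau>) j)) = (\<Sum>j\<in>{1..t}. 1 / r (x j))"
    unfolding sum.permute[OF assms(3), of "\<lambda>j. 1 / r (x j)"] by (simp only: o_def)
  ultimately show ?thesis by (simp only: LRatio_power[OF assms(1,2)] assms(4))
qed

lemma one_null_expectation_eq: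
  fixes f :: "(nat \<Rightarrow> 's) \<Rightarrow> real"
  assumes "i \<in> {1..t}" "j \<in> {1..t}"
    and "\<And>\<tau> x. \<tau> permutes {1..t} \<Longrightarrow> x \<in> {1..t} \<rightarrow>\<^sub>E S \<Longrightarrow> f (x \<circ> \<tau>) = f x"
  shows "measure_pmf.expectation (one_null t i) f = measure_pmf.expectation (one_null t j) f"
proof -
  define \<tau> where "\<tau> = Transposition.transpose i j"
  have \<tau>: "\<tau> permutes {1..t}" unfolding \<tau>_def using assms(1,2) by (rule permutes_swap_id)
  have "((\<lambda>_. dist M h1)(j := mix)) = ((\<lambda>_. dist M h1)(i := mix)) \<circ> \<tau>"
    by (auto simp: fun_eq_iff \<tau>_def Transposition.transpose_def)
  then have "one_null t j = map_pmf (\<lambda>x. x \<circ> \<tau>) (one_null t i)"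
    unfolding one_null_def using Pi_pmf_permute[OF _ \<tau>] by simp
  then have "measure_pmf.expectation (one_null t j) f =
      measure_pmf.expectation (one_null t i) (\<lambda>x. f (x \<circ> \<tau>))" by simp
  also have "\<dots> = measure_pmf.expectation (one_null t i) f"
    using assms(3)[OF \<tau>] by (intro expectation_cong_on_support[OF finite_vectors set_one_null])
  finally show ?thesis ..
qed

text \<open>
  Each component of \<open>\<theta>\<close> is moved up in the stochastic order: the component \<open>j\<close> to the mixture,
  every other one to \<open>h1\<close>, where a component in \<open>H0\<close> passes through the mixture.
\<close>

lemma size_at_power_le_one_null:
  fixes f :: "(nat \<Rightarrow> 's) \<Rightarrow> real"
  assumes "uniformly_least_favorable M H0 h1 \<Lambda>" "\<theta> \<in> Ext_set H0 h1 t"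
    and "j \<in> {1..t}" "\<theta> j \<in> H0"
    and "monotone_on ({1..t} \<rightarrow>\<^sub>E S) (\<lambda>x y. \<forall>i\<in>{1..t}. r (x i) \<le> r (y i)) (\<le>) f"
  shows "size_at (model_power M t) f \<theta> \<le> measure_pmf.expectation (one_null t j) f"
proof -
  have "stoch_le r (dist M (\<theta> i)) (((\<lambda>_. dist M h1)(j := mix)) i)" if "i \<in> {1..t}" for i
  proof (cases "i = j")
    case True
    then show ?thesis using null_stoch_le_mix[OF assms(1,4)] by simp
  next
    case False
    have "\<theta> i \<in> H0 \<union> {h1}" using assms(2) that by (auto simp: Ext_set_def)
    then show ?thesis
      using False stoch_le_refl stoch_le_trans[OF null_stoch_le_mix[OF assms(1)] mix_stoch_le_alt]
      by auto
  qed
  moreover have "\<theta> i \<in> params M" if "i \<in> {1..t}" for i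
    using assms(2) Ext_set_subset that by blast
  ultimately show ?thesis
    unfolding size_at_def one_null_def model_power_def stat_model.simps
    using set_dist set_alt set_mix
    by (intro stoch_le_Pi_pmf_expectation[OF _ finite_samples _ _ _ assms(5)]) auto
qed

lemma Ext_pmf_uniformly_least_favorable:
  assumes "t \<ge> 1" "h1 \<notin> H0" "uniformly_least_favorable M H0 h1 \<Lambda>"
  shows "uniformly_least_favorable (model_power M t)
    (Ext_set H0 h1 t) (const_vec h1 t) (Ext_pmf \<Lambda> h1 t)"
proof -
  interpret P: testing_problem "model_power M t" "Ext_set H0 h1 t" "const_vec h1 t" "Ext_pmf \<Lambda> h1 t"
    by (rule testing_problem_power[OF assms(1,2)])
  have "least_favorable (model_power M t) (Ext_set H0 h1 t) (const_vec h1 t) \<alpha> (Ext_pmf \<Lambda> h1 t)"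
    if \<alpha>: "0 < \<alpha>" "\<alpha> < 1" for \<alpha>
    unfolding P.least_favorable_iff[OF \<alpha>]
  proof
    let ?f = "LR_test (model_power M t) (Ext_set H0 h1 t) (const_vec h1 t) (Ext_pmf \<Lambda> h1 t) \<alpha>"
    obtain k \<gamma> where \<gamma>: "0 \<le> \<gamma>" "\<gamma> \<le> 1"
      and f: "?f = threshold_test (model_power M t) (Ext_set H0 h1 t) (const_vec h1 t)
        (Ext_pmf \<Lambda> h1 t) k \<gamma>"
      and mean: "measure_pmf.expectation P.mix ?f = \<alpha>"
      using P.LR_test_is_threshold_test[OF \<alpha>] by metis
    have mono: "monotone_on ({1..t} \<rightarrow>\<^sub>E S) (\<lambda>x y. \<forall>i\<in>{1..t}. r (x i) \<le> r (y i)) (\<le>) ?f"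
      unfolding f
      by (intro monotone_onI P.threshold_test_isotone[OF \<gamma>] LRatio_power_mono[OF assms(1,2)])
    have sym: "?f (x \<circ> \<tau>) = ?f x" if "\<tau> permutes {1..t}" "x \<in> {1..t} \<rightarrow>\<^sub>E S" for \<tau> x
      unfolding f threshold_test_def LRatio_power_permute[OF assms(1,2) that] ..
    fix \<theta> assume \<theta>: "\<theta> \<in> Ext_set H0 h1 t"
    obtain j where j: "j \<in> {1..t}" "\<theta> j \<noteq> h1"
    proof -
      have "\<theta> \<in> extensional {1..t}" "const_vec h1 t \<in> extensional {1..t}" "\<theta> \<noteq> const_vec h1 t"
        using \<theta> by (auto simp: Ext_set_def PiE_def const_vec_def)
      then obtain j where "j \<in> {1..t}" "\<theta> j \<noteq> const_vec h1 t j"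
        by (metis extensionalityI)
      then show ?thesis using that by (simp add: const_vec_def)
    qed
    then have "\<theta> j \<in> H0" using \<theta> by (auto simp: Ext_set_def)
    then have "size_at (model_power M t) ?f \<theta> \<le> measure_pmf.expectation (one_null t j) ?f"
      using size_at_power_le_one_null[OF assms(3) \<theta> j(1) _ mono] by simp
    also have "\<dots> = \<alpha>"
    proof -
      have "\<alpha> = measure_pmf.expectation (bind_pmf (pmf_of_set {1..t}) (one_null t)) ?f"
        using mean by (simp add: P.mix_def Ext_mix_eq[OF assms(1)])
      also have "\<dots> = (\<Sum>i\<in>{1..t}. measure_pmf.expectation (one_null t i) ?f / real t)"
        using assms(1) finite_subset[OF set_one_null finite_vectors]
        by (subst pmf_expectation_bind_pmf_of_set) (auto simp: divide_inverse_commute)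
      also have "\<dots> = (\<Sum>i\<in>{1..t}. measure_pmf.expectation (one_null t j) ?f / real t)"
        using one_null_expectation_eq[OF _ j(1) sym] by (intro sum.cong) simp_all
      finally show ?thesis using assms(1) by simp
    qed
    finally show "size_at (model_power M t) ?f \<theta> \<le> \<alpha>" .
  qed
  then show ?thesis by (simp add: uniformly_least_favorable_def)
qed

end

theorem lemma7:
  fixes M :: "('s, 'p) stat_model" and H0 :: "'p set" and h1 :: 'p
    and \<Lambda> :: "'p pmf" and t :: nat
  assumes "finite_stat_model M"
    and "t \<ge> 1"
    and "H0 \<subseteq> params M"
    and "h1 \<in> params M - H0"
    and "ratio_positive M H0 h1 \<Lambda>"
    and "uniformly_least_favorable M H0 h1 \<Lambda>"
  shows "uniformly_least_favorable (model_power M t)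
           (Ext_set H0 h1 t) (const_vec h1 t) (Ext_pmf \<Lambda> h1 t)"
proof -
  \<comment> \<open>Least favorability at any single level already contains the support condition on \<open>\<Lambda>\<close>.\<close>
  have "least_favorable M H0 h1 (1 / 2) \<Lambda>"
    using assms(6) by (simp add: uniformly_least_favorable_def)
  then have "set_pmf \<Lambda> \<subseteq> H0" by (simp add: least_favorable_def)
  then interpret testing_problem M H0 h1 \<Lambda>
    using assms by unfold_locales auto
  show ?thesis using assms by (intro Ext_pmf_uniformly_least_favorable) auto
qed

end
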